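(* Let $K\ge2$, let $1=s_1\le s_2\le\cdots\le s_K$ be real numbers, and let $\boldsymbol{c}=(c_1,\dots,c_K)\in\mathbb{R}^K$ with $\boldsymbol{c}^T\boldsymbol{c}=1$. Consider the problem $$\min_{\tilde{\boldsymbol{x}}\in\mathbb{R}^K}\ \tfrac12\sum_{k=1}^K s_k\tilde x_k^2+\sum_{k=1}^K c_k\tilde x_k\quad\text{s.t. }\tilde{\boldsymbol{x}}^T\tilde{\boldsymbol{x}}=1 .$$ Suppose that exactly one of the coefficients of $\boldsymbol{c}$ is zero, namely $c_n=0$, and that $n>1$. Then the minimiser $\tilde{\boldsymbol{x}}^\star$ of this problem satisfies $\tilde x_n^\star=0$.
   Context: "Minimiser" means global minimiser. *)

theory Defs
  imports Complex_Main
begin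

text \<open>A vector of \<open>\<real>\<^sup>K\<close> is a function \<open>nat \<Rightarrow> real\<close> read on the indices \<open>1, \<dots>, K\<close> only;
  its values at other arguments are irrelevant.\<close>

definition objective :: "nat \<Rightarrow> (nat \<Rightarrow> real) \<Rightarrow> (nat \<Rightarrow> real) \<Rightarrow> (nat \<Rightarrow> real) \<Rightarrow> real" where
  "objective K s c x = 1 / 2 * (\<Sum>k=1..K. s k * (x k)\<^sup>2) + (\<Sum>k=1..K. c k * x k)"

definition unit_vector :: "nat \<Rightarrow> (nat \<Rightarrow> real) \<Rightarrow> bool" where
  "unit_vector K x \<longleftrightarrow> (\<Sum>k=1..K. x k * x k) = 1"

definition minimiser :: "nat \<Rightarrow> (nat \<Rightarrow> real) \<Rightarrow> (nat \<Rightarrow> real) \<Rightarrow> (nat \<Rightarrow> real) \<Rightarrow> bool" where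
  "minimiser K s c x \<longleftrightarrow> is_arg_min (objective K s c) (unit_vector K) x"

end

theory Submission
  imports Defs
begin

text \<open>If \<open>c n = 0\<close>, the coordinate \<open>x n\<close> enters the objective only through \<open>s n * (x n)\<^sup>2 / 2\<close>. Its
  share of the norm can be put to better use at a coordinate \<open>m\<close> with \<open>s m \<le> s n\<close> and \<open>c m \<noteq> 0\<close>:
  replacing \<open>(x m, x n)\<close> by \<open>(- sgn (c m) * r, 0)\<close> with \<open>r\<^sup>2 = (x m)\<^sup>2 + (x n)\<^sup>2\<close> stays on the sphere,
  does not increase the quadratic part, and strictly decreases the linear part when \<open>x n \<noteq> 0\<close>,
  because then \<open>r > \<bar>x m\<bar>\<close>. Under the ordering of \<open>s\<close>, with \<open>n > 1\<close> the only index at which \<open>c\<close>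
  vanishes, the index \<open>m = 1\<close> qualifies.\<close>

lemma sum_split_two:
  fixes f :: "'a \<Rightarrow> 'b::comm_monoid_add"
  assumes "finite A" "m \<in> A" "n \<in> A" "m \<noteq> n"
  shows "sum f A = f m + (f n + sum f (A - {m, n}))"
proof -
  have "A - {m, n} = A - {m} - {n}"
    by blast
  with assms show ?thesis
    by (simp add: sum.remove[of A m] sum.remove[of "A - {m}" n])
qed

text \<open>The competitor \<open>y\<close> below moves the whole mass of coordinate \<open>n\<close> to coordinate \<open>m\<close>, where it
  costs no more in the quadratic part and, with the sign opposite to that of \<open>c m\<close>, gains in the
  linear part.\<close>

lemma minimiser_eq_0_if_mass_absorbed:
  assumes min: "minimiser K s c x"
    and mn: "m \<in> {1..K}" "n \<in> {1..K}" "m \<noteq> n"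
    and s_le: "s m \<le> s n"
    and c: "c m \<noteq> 0" "c n = 0"
  shows "x n = 0"
proof (rule ccontr)
  assume xn: "x n \<noteq> 0"
  define r where "r = sqrt ((x m)\<^sup>2 + (x n)\<^sup>2)"
  define y where "y = x(m := - sgn (c m) * r, n := 0)"
  have ym: "y m = - sgn (c m) * r" and yn: "y n = 0"
    using mn(3) by (simp_all add: y_def)
  have r_sq: "r\<^sup>2 = (x m)\<^sup>2 + (x n)\<^sup>2"
    by (simp add: r_def)
  have ym_sq: "(y m)\<^sup>2 = (x m)\<^sup>2 + (x n)\<^sup>2"
    using c(1) by (simp add: ym power_mult_distrib sgn_if r_sq)
  note sum_mn = sum_split_two[OF finite_atLeastAtMost mn]
  have rest: "(\<Sum>k\<in>{1..K} - {m, n}. g k (y k)) = (\<Sum>k\<in>{1..K} - {m, n}. g k (x k))"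
    for g :: "nat \<Rightarrow> real \<Rightarrow> real"
    by (rule sum.cong) (auto simp: y_def)

  have unit_y: "unit_vector K y"
  proof -
    have "unit_vector K x"
      using min by (simp add: minimiser_def is_arg_min_def)
    then show ?thesis
      using ym_sq rest[of "\<lambda>_ t. t * t"]
      by (simp add: unit_vector_def sum_mn yn power2_eq_square del: One_nat_def)
  qed

  have quadratic: "(\<Sum>k=1..K. s k * (y k)\<^sup>2) \<le> (\<Sum>k=1..K. s k * (x k)\<^sup>2)"
  proof -
    have "s m * (x n)\<^sup>2 \<le> s n * (x n)\<^sup>2"
      using s_le by (simp add: mult_right_mono)
    then show ?thesis
      using rest[of "\<lambda>k t. s k * t\<^sup>2"] by (simp add: sum_mn ym_sq yn distrib_left del: One_nat_def)
  qed

  have linear: "(\<Sum>k=1..K. c k * y k) < (\<Sum>k=1..K. c k * x k)"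
  proof -
    have "\<bar>x m\<bar> < r"
      unfolding r_def using xn by (intro real_less_rsqrt) simp
    then have "\<bar>c m\<bar> * \<bar>x m\<bar> < \<bar>c m\<bar> * r"
      using c(1) by simp
    moreover have "- (\<bar>c m\<bar> * \<bar>x m\<bar>) \<le> c m * x m"
      by (metis abs_ge_minus_self abs_mult minus_le_iff)
    moreover have "c m * y m = - (\<bar>c m\<bar> * r)"
      by (simp add: ym abs_sgn)
    ultimately have "c m * y m < c m * x m"
      by linarith
    then show ?thesis
      using rest[of "\<lambda>k t. c k * t"] c(2) by (simp add: sum_mn del: One_nat_def)
  qed

  have "objective K s c y < objective K s c x"
    unfolding objective_def using quadratic linear by linarith
  with min unit_y show False
    by (auto simp: minimiser_def is_arg_min_def)
qed

theorem lemma6: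
  fixes K n :: nat and s c x :: "nat \<Rightarrow> real"
  assumes "K \<ge> 2"
    and "s 1 = 1"
    and "mono_on {1..K} s"
    and "unit_vector K c"
    and "{k \<in> {1..K}. c k = 0} = {n}"
    and "n > 1"
    and "minimiser K s c x"
  shows "x n = 0"
proof (rule minimiser_eq_0_if_mass_absorbed[OF assms(7), where m = 1])
  show n: "n \<in> {1..K}" and "c n = 0"
    using assms(5) by blast+
  show one: "1 \<in> {1..K}" and "1 \<noteq> n"
    using assms(1,6) by auto
  then show "c 1 \<noteq> 0"
    using assms(5) by blast
  show "s 1 \<le> s n"
    using assms(3,6) one n by (auto intro: mono_onD)
qed

end
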